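(* Let $0<\alpha<1$ and $\beta\ge0$, and let $w_{\alpha,\beta}\in L^1_{\mathrm{loc}}(0,\infty)$ be the kernel determined by $\mathcal{L}[w_{\alpha,\beta}](s)=\Phi_{\alpha,\beta}(s)/s$ for $\Re s>0$, where $\Phi_{\alpha,\beta}(s)=s^\alpha\bigl(1+(1-\alpha)s^{\alpha-1}\bigr)^{-\beta}$. Then $$w_{\alpha,\beta}(t)=t^{-\alpha}\,E^{\beta}_{1-\alpha,\,1-\alpha}\bigl(-(1-\alpha)t^{1-\alpha}\bigr),\qquad t>0.$$
   Context: Complex powers are principal branches on $\mathbb{C}\setminus(-\infty,0]$. $\mathcal{L}[g](s)=\int_0^\infty e^{-st}g(t)\,dt$ is the Laplace transform. $L^1_{\mathrm{loc}}(0,\infty)$ means integrable on $(0,T)$ for every finite $T>0$; $w_{\alpha,\beta}$ is determined up to a.e. equality and identified with its continuous representative. The Prabhakar (three-parameter Mittag-Leffler) function is $E^\gamma_{\rho,\delta}(z)=\sum_{n\ge0}\frac{(\gamma)_n}{n!\,\Gamma(\rho n+\delta)}z^n$, with $(\gamma)_n=\gamma(\gamma+1)\cdots(\gamma+n-1)$, $(\gamma)_0=1$. *)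

theory Defs
  imports "HOL-Analysis.Analysis"
begin

text \<open>\<open>powr\<close> on type \<^typ>\<open>complex\<close> is the principal branch,
  \<open>s powr a = exp (a * Ln s)\<close> for \<open>s \<noteq> 0\<close>. For \<open>0 < \<alpha> < 1\<close> and \<open>Re s > 0\<close> both bases
  below have positive real part, so they avoid the cut.\<close>

definition Phi :: "real \<Rightarrow> real \<Rightarrow> complex \<Rightarrow> complex" where
  "Phi \<alpha> \<beta> s =
     s powr of_real \<alpha> *
     (1 + of_real (1 - \<alpha>) * s powr of_real (\<alpha> - 1)) powr of_real (- \<beta>)"

definition prabhakar :: "'a::Gamma \<Rightarrow> 'a \<Rightarrow> 'a \<Rightarrow> 'a \<Rightarrow> 'a" where
  "prabhakar \<gamma> \<rho> \<delta> z =
     (\<Sum>n. pochhammer \<gamma> n / (fact n * Gamma (\<rho> * of_nat n + \<delta>)) * z ^ n)"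

text \<open>Integrability up to the left endpoint \<open>0\<close> is required, not only on compact
  subsets of \<open>(0,\<infinity>)\<close>.\<close>

definition L1_loc :: "(real \<Rightarrow> complex) \<Rightarrow> bool" where
  "L1_loc g \<longleftrightarrow> (\<forall>T>0. g absolutely_integrable_on {0<..<T})"

text \<open>The Laplace integral is a Lebesgue integral. A Bochner integral that does not exist
  has the value 0, so convergence is recorded separately.\<close>

definition laplace_converges :: "(real \<Rightarrow> complex) \<Rightarrow> complex \<Rightarrow> bool" where
  "laplace_converges g s \<longleftrightarrow>
     (\<lambda>t. exp (- (s * of_real t)) * g t) absolutely_integrable_on {0<..}"

definition laplace :: "(real \<Rightarrow> complex) \<Rightarrow> complex \<Rightarrow> complex" where
  "laplace g s = (LINT t:{0<..}|lebesgue. exp (- (s * of_real t)) * g t)"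

definition is_kernel :: "real \<Rightarrow> real \<Rightarrow> (real \<Rightarrow> complex) \<Rightarrow> bool" where
  "is_kernel \<alpha> \<beta> w \<longleftrightarrow> L1_loc w \<and>
     (\<forall>s. Re s > 0 \<longrightarrow> laplace_converges w s \<and> laplace w s = Phi \<alpha> \<beta> s / s)"

text \<open>Two continuous functions on \<open>(0,\<infinity>)\<close> that agree almost everywhere agree
  everywhere on \<open>(0,\<infinity>)\<close>, so when a continuous representative exists the choice
  is immaterial at every \<open>t > 0\<close>. Values at \<open>t \<le> 0\<close> carry no meaning.\<close>

definition continuous_representative :: "(real \<Rightarrow> complex) \<Rightarrow> real \<Rightarrow> complex" where
  "continuous_representative w =
     (SOME v. continuous_on {0<..} v \<and> (AE t in lebesgue_on {0<..}. v t = w t))"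

end

theory Submission
  imports Defs
begin

text \<open>Integrating the Prabhakar series termwise against \<open>exp (- s t)\<close> turns it into a
  binomial series, so the right-hand side has Laplace transform \<open>\<Phi>(s)/s\<close> for every real
  \<open>s \<ge> 1\<close>. A kernel is determined almost everywhere by the values of its Laplace transform
  at the positive integers: after the substitution \<open>x = exp (- t)\<close> these are moments on
  \<open>[0,1]\<close>, and the Weierstrass theorem applies. Both sides of the claim being continuous,
  equality almost everywhere is equality everywhere.\<close>

section \<open>Uniqueness from exponential moments on the half-line\<close>

lemma borel_measurable_lebesgue_onI:
  assumes "f \<in> borel_measurable borel"
  shows "f \<in> borel_measurable (lebesgue_on S)"
  using assms by (intro measurable_restrict_space1 measurable_completion) simp

text \<open>Vanishing moments annihilate every polynomial in \<open>exp (- t)\<close>, hence, by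
  uniform approximation, every \<open>F (exp (- t))\<close> with \<open>F\<close> continuous on
  \<open>{0..1}\<close>. Such functions converge boundedly to \<open>exp (- t) * sgn (h t)\<close>,
  so the integral of \<open>exp (- t) * \<bar>h t\<bar>\<close> is zero.\<close>

lemma AE_zero_if_exp_moments_zero:
  fixes h :: "real \<Rightarrow> real"
  defines "M \<equiv> lebesgue_on {0<..}"
  assumes h: "integrable M h"
    and moments: "\<And>k::nat. (\<integral>t. exp (- real k * t) * h t \<partial>M) = 0"
  shows "AE t in M. h t = 0"
proof -
  have [measurable]: "h \<in> borel_measurable M"
    using h by auto
  have space: "space M = {0<..}"
    by (simp add: M_def space_restrict_space)
  have exp_meas [measurable]: "(\<lambda>t. exp (- t)) \<in> borel_measurable M"
    unfolding M_def by (rule borel_measurable_lebesgue_onI) measurable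
  have bounded_mult: "integrable M (\<lambda>t. g t * h t)"
    if "g \<in> borel_measurable M" "\<And>t. t > 0 \<Longrightarrow> \<bar>g t\<bar> \<le> B" for g B
  proof (rule Bochner_Integration.integrable_bound)
    show "integrable M (\<lambda>t. B * h t)"
      using h by simp
    show "AE t in M. norm (g t * h t) \<le> norm (B * h t)"
    proof (rule AE_I2)
      fix t assume "t \<in> space M"
      then have "\<bar>g t\<bar> \<le> \<bar>B\<bar>" using that(2)[of t] space by auto
      then show "norm (g t * h t) \<le> norm (B * h t)"
        by (simp add: abs_mult mult_right_mono)
    qed
  qed (use that in measurable)
  have poly: "(\<integral>t. (\<Sum>i\<le>n. a i * exp (- t) ^ i) * h t \<partial>M) = 0" for a :: "nat \<Rightarrow> real" and n
  proof -
    have "integrable M (\<lambda>t. exp (- real i * t) * h t)" for i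
      by (rule bounded_mult[of _ 1])
        (auto simp: M_def intro!: borel_measurable_lebesgue_onI)
    then have "(\<integral>t. (\<Sum>i\<le>n. a i * (exp (- real i * t) * h t)) \<partial>M) = 0"
      by (subst Bochner_Integration.integral_sum) (use moments in auto)
    moreover have "exp (- real i * t) = exp (- t) ^ i" for i t
      using exp_of_nat_mult[of i "- t"] by simp
    ultimately show ?thesis
      by (simp add: sum_distrib_right mult.assoc)
  qed
  have cont: "(\<integral>t. F (exp (- t)) * h t \<partial>M) = 0" if F: "continuous_on {0..1} F" for F :: "real \<Rightarrow> real"
  proof -
    define B where "B = (\<integral>t. \<bar>h t\<bar> \<partial>M)"
    have Fm: "(\<lambda>t. F (exp (- t))) \<in> borel_measurable M"
    proof -
      have "continuous_on {0<..} (\<lambda>t::real. F (exp (- t)))"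
        by (rule continuous_on_compose2[OF F]) (auto intro!: continuous_intros)
      then show ?thesis
        unfolding M_def by (intro continuous_imp_measurable_on_sets_lebesgue) auto
    qed
    have "bounded (F ` {0..1})"
      using F by (intro compact_imp_bounded compact_continuous_image) auto
    then obtain C where C: "\<And>x. x \<in> {0..1} \<Longrightarrow> \<bar>F x\<bar> \<le> C"
      unfolding bounded_iff real_norm_def by blast
    have Fint: "integrable M (\<lambda>t. F (exp (- t)) * h t)"
      by (rule bounded_mult[OF Fm, of C]) (auto intro!: C)
    have "\<bar>\<integral>t. F (exp (- t)) * h t \<partial>M\<bar> \<le> e * B" if "e > 0" for e
    proof -
      obtain p where p: "real_polynomial_function p" "\<And>x. x \<in> {0..1} \<Longrightarrow> \<bar>F x - p x\<bar> < e"
        using Stone_Weierstrass_real_polynomial_function[OF compact_Icc F \<open>e > 0\<close>] by blast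
      then obtain a n where a: "p = (\<lambda>x. \<Sum>i\<le>n. a i * x ^ i)"
        unfolding real_polynomial_function_iff_sum by blast
      have pm: "(\<lambda>t. p (exp (- t))) \<in> borel_measurable M"
        unfolding a by measurable
      have pint: "integrable M (\<lambda>t. p (exp (- t)) * h t)"
      proof (rule bounded_mult[OF pm, of "C + e"])
        fix t :: real assume "t > 0"
        then show "\<bar>p (exp (- t))\<bar> \<le> C + e"
          using p(2)[of "exp (- t)"] C[of "exp (- t)"] by auto
      qed
      \<comment> \<open>The polynomial integral is zero by \<open>poly\<close>, so it can be
        subtracted freely; the uniform error \<open>e\<close> then bounds what remains against the
        integral of \<open>\<bar>h t\<bar>\<close>.\<close>
      have "(\<integral>t. F (exp (- t)) * h t \<partial>M)
          = (\<integral>t. F (exp (- t)) * h t \<partial>M) - (\<integral>t. p (exp (- t)) * h t \<partial>M)"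
        using poly[of a n] by (simp add: a)
      also have "\<dots> = (\<integral>t. F (exp (- t)) * h t - p (exp (- t)) * h t \<partial>M)"
        using Fint pint by simp
      also have "\<bar>\<dots>\<bar> \<le> (\<integral>t. \<bar>F (exp (- t)) * h t - p (exp (- t)) * h t\<bar> \<partial>M)"
        by (rule integral_abs_bound)
      also have "\<dots> \<le> (\<integral>t. e * \<bar>h t\<bar> \<partial>M)"
      proof (rule integral_mono)
        fix t assume "t \<in> space M"
        then have "\<bar>F (exp (- t)) - p (exp (- t))\<bar> \<le> e"
          using p(2)[of "exp (- t)"] space by auto
        then show "\<bar>F (exp (- t)) * h t - p (exp (- t)) * h t\<bar> \<le> e * \<bar>h t\<bar>"
          by (simp add: abs_mult mult_right_mono flip: left_diff_distrib)
      qed (use Fint pint h in auto)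
      also have "\<dots> = e * B"
        by (simp add: B_def)
      finally show ?thesis .
    qed note * = this
    have "B \<ge> 0" by (simp add: B_def)
    have "\<bar>\<integral>t. F (exp (- t)) * h t \<partial>M\<bar> \<le> 0"
    proof (rule field_le_epsilon)
      fix e :: real assume "e > 0"
      \<comment> \<open>Dividing by \<open>B + 1\<close> instead of \<open>B\<close> also covers the
        case \<open>B = 0\<close>.\<close>
      have "e / (B + 1) * B \<le> e"
        using \<open>B \<ge> 0\<close> \<open>e > 0\<close> by (simp add: field_simps)
      then show "\<bar>\<integral>t. F (exp (- t)) * h t \<partial>M\<bar> \<le> 0 + e"
        using *[of "e / (B + 1)"] \<open>B \<ge> 0\<close> \<open>e > 0\<close> by auto
    qed
    then show ?thesis by simp
  qed
  \<comment> \<open>Testing against continuous \<open>c n\<close> that tend to \<open>sgn h\<close>; the factor \<open>exp (- t)\<close> makes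
    the test function, as a function of \<open>x = exp (- t)\<close>, continuous at \<open>x = 0\<close>.\<close>
  have "(\<lambda>t. sgn (h t)) measurable_on {0<..}"
    by (subst measurable_on_iff_borel_measurable) (auto simp flip: M_def)
  then obtain N g where N: "negligible N" and g: "\<And>n. continuous_on UNIV (g n)"
    and lim: "\<And>t. t \<notin> N \<Longrightarrow> (\<lambda>n. g n t) \<longlonglongrightarrow> (if t \<in> {0<..} then sgn (h t) else 0)"
    unfolding measurable_on_def by blast
  \<comment> \<open>The functions \<open>g n\<close> may be unbounded. Clamping to the interval from
    -1 to 1 keeps continuity, supplies a dominating function, and preserves the limit because
    \<open>sgn\<close> takes values in that interval.\<close>
  define c :: "nat \<Rightarrow> real \<Rightarrow> real" where "c n t = max (-1) (min 1 (g n t))" for n t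
  have c_bound: "\<bar>c n t\<bar> \<le> 1" for n t
    by (auto simp: c_def)
  have c_cont: "continuous_on UNIV (c n)" for n
    unfolding c_def by (intro continuous_intros g)
  have c_meas [measurable]: "c n \<in> borel_measurable M" for n
    unfolding M_def using c_cont
    by (intro borel_measurable_lebesgue_onI borel_measurable_continuous_onI)
  have c_zero: "(\<integral>t. c n t * (exp (- t) * h t) \<partial>M) = 0" for n
  proof -
    \<comment> \<open>Chosen so that \<open>F (exp (- t)) = exp (- t) * c n t\<close>, which makes
      the claim an instance of \<open>cont\<close>.\<close>
    define F where "F x = (if x = 0 then 0 else x * c n (- ln x))" for x
    have "continuous_on {0..1} F"
      unfolding continuous_on_eq_continuous_within
    proof
      fix x :: real assume x: "x \<in> {0..1}"
      show "continuous (at x within {0..1}) F"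
      proof (cases "x = 0")
        case True
        have "(F \<longlongrightarrow> 0) (at 0)"
        proof (rule Lim_null_comparison)
          show "\<forall>\<^sub>F x in at 0. norm (F x) \<le> \<bar>x\<bar>"
            using c_bound[of n] by (auto simp: F_def abs_mult mult_left_le)
          show "((\<lambda>x::real. \<bar>x\<bar>) \<longlongrightarrow> 0) (at 0)"
            by (intro tendsto_eq_intros) auto
        qed
        then show ?thesis
          using True by (auto simp: continuous_within F_def intro: tendsto_within_subset)
      next
        case False
        then have "x > 0" using x by auto
        have "continuous_on {0<..} (\<lambda>x::real. x * c n (- ln x))"
          by (intro continuous_intros continuous_on_compose2[OF c_cont]) auto
        then have "continuous_on {0<..} F"
          by (rule continuous_on_eq) (auto simp: F_def)
        then have "isCont F x"
          using \<open>x > 0\<close> by (simp add: continuous_on_eq_continuous_at)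
        then show ?thesis
          by (rule continuous_at_imp_continuous_within)
      qed
    qed
    from cont[OF this] show ?thesis
      by (simp add: F_def mult_ac)
  qed
  have "(\<lambda>n. \<integral>t. c n t * (exp (- t) * h t) \<partial>M) \<longlonglongrightarrow> (\<integral>t. sgn (h t) * (exp (- t) * h t) \<partial>M)"
  proof (rule integral_dominated_convergence)
    show "integrable M (\<lambda>t. \<bar>h t\<bar>)" using h by simp
    show "AE t in M. norm (c n t * (exp (- t) * h t)) \<le> \<bar>h t\<bar>" for n
    proof (rule AE_I2)
      fix t assume "t \<in> space M"
      then have "\<bar>c n t\<bar> * exp (- t) \<le> 1 * 1"
        using space by (intro mult_mono c_bound) auto
      then show "norm (c n t * (exp (- t) * h t)) \<le> \<bar>h t\<bar>"
        by (simp add: abs_mult mult_left_le_one_le flip: mult.assoc)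
    qed
    have "AE t in lebesgue. t \<notin> N"
      using N by (simp add: AE_not_in negligible_iff_null_sets)
    then have "AE t in M. t \<notin> N"
      unfolding M_def by (subst AE_restrict_space_iff) auto
    then show "AE t in M. (\<lambda>n. c n t * (exp (- t) * h t)) \<longlonglongrightarrow> sgn (h t) * (exp (- t) * h t)"
    proof (rule AE_mp, intro AE_I2 impI)
      fix t assume "t \<in> space M" "t \<notin> N"
      then have "(\<lambda>n. g n t) \<longlonglongrightarrow> sgn (h t)"
        using lim[of t] space by simp
      then have "(\<lambda>n. c n t) \<longlonglongrightarrow> max (-1) (min 1 (sgn (h t)))"
        unfolding c_def by (intro tendsto_intros)
      also have "max (-1) (min 1 (sgn (h t))) = sgn (h t)"
        by (simp add: sgn_if)
      finally show "(\<lambda>n. c n t * (exp (- t) * h t)) \<longlonglongrightarrow> sgn (h t) * (exp (- t) * h t)"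
        by (rule tendsto_mult_right)
    qed
  qed measurable
  then have "(\<integral>t. sgn (h t) * (exp (- t) * h t) \<partial>M) = 0"
    by (simp add: c_zero LIMSEQ_const_iff)
  moreover have eq: "sgn (h t) * (exp (- t) * h t) = exp (- t) * \<bar>h t\<bar>" for t
    by (simp add: sgn_if)
  moreover have "integrable M (\<lambda>t. exp (- t) * \<bar>h t\<bar>)"
    using integrable_abs[OF bounded_mult[OF exp_meas, of 1]] by (simp add: abs_mult)
  ultimately have "AE t in M. exp (- t) * \<bar>h t\<bar> = 0"
    by (subst (asm) eq, subst (asm) integral_nonneg_eq_0_iff_AE) auto
  then show ?thesis by simp
qed

section \<open>Laplace transform of a real power\<close>

text \<open>Euler's integral for \<open>Gamma b\<close> under the substitution of
  \<open>s * t\<close> for \<open>t\<close>.\<close>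

lemma Laplace_power:
  fixes s b :: real
  assumes s: "s > 0" and b: "b > 0"
  shows "has_bochner_integral (lebesgue_on {0<..}) (\<lambda>t. exp (- s * t) * t powr (b - 1))
    (Gamma b * s powr (- b))"
proof -
  let ?f = "\<lambda>t::real. indicator {0<..} t * (exp (- t) * t powr (b - 1))"
  let ?g = "\<lambda>t::real. indicator {0<..} t * (exp (- s * t) * t powr (b - 1))"
  have "(\<integral>\<^sup>+t. ennreal (?f t) \<partial>lborel) = ennreal (Gamma b)"
    unfolding Gamma_conv_nn_integral_real[OF b]
    by (intro nn_integral_cong) (auto simp: indicator_def exp_minus field_simps)
  then have "has_bochner_integral lborel ?f (Gamma b)"
    using b by (subst (asm) nn_integral_eq_integrable)
      (auto simp: has_bochner_integral_iff less_imp_le[OF Gamma_real_pos])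
  then have "has_bochner_integral lborel (\<lambda>t. ?f (0 + s * t)) (Gamma b /\<^sub>R \<bar>s\<bar>)"
    using s by (subst (asm) lborel_has_bochner_integral_real_affine_iff[of s _ _ 0]) auto
  \<comment> \<open>The factor \<open>s powr (1 - b)\<close> cancels the
    \<open>s powr (b - 1)\<close> that the substitution leaves in the integrand; the division by
    \<open>s\<close> in the value is the Jacobian.\<close>
  from has_bochner_integral_mult_right[OF this, of "s powr (1 - b)"]
  have "has_bochner_integral lborel ?g (s powr (1 - b) * (Gamma b / s))"
    using s by (elim has_bochner_integral_cong[THEN iffD1, rotated 3])
      (auto simp: indicator_def powr_mult powr_diff field_simps zero_less_mult_iff)
  also have "s powr (1 - b) * (Gamma b / s) = Gamma b * s powr (- b)"
    using s by (simp add: powr_diff powr_minus field_simps)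
  finally have "has_bochner_integral lebesgue ?g (Gamma b * s powr (- b))"
    by (simp add: has_bochner_integral_iff integrable_completion integral_completion)
  then show ?thesis
    by (simp add: has_bochner_integral_iff integrable_restrict_space integral_restrict_space)
qed

section \<open>Convergence and continuity of the Prabhakar series\<close>

text \<open>Up to the sign \<open>(-1) ^ n\<close> the coefficients are those of the binomial series
  with exponent \<open>- \<gamma>\<close>. That series converges at a point \<open>y\<close>
  strictly between \<open>\<bar>x\<bar>\<close> and 1, and a power series convergent at
  \<open>y\<close> converges absolutely at \<open>x\<close>.\<close>

lemma summable_abs_pochhammer_powser:
  fixes \<gamma> x :: real
  assumes "\<bar>x\<bar> < 1"
  shows "summable (\<lambda>n. \<bar>pochhammer \<gamma> n / fact n * x ^ n\<bar>)"
proof -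
  define y where "y = (\<bar>x\<bar> + 1) / 2"
  have "\<bar>y\<bar> < 1" "\<bar>x\<bar> < y" using assms by (auto simp: y_def)
  have "summable (\<lambda>n. ((- \<gamma>) gchoose n) * y ^ n)"
    using gen_binomial_real[OF \<open>\<bar>y\<bar> < 1\<close>] sums_summable by blast
  then have "summable (\<lambda>n. norm (((- \<gamma>) gchoose n) * x ^ n))"
    by (rule powser_insidea) (use \<open>\<bar>x\<bar> < y\<close> in auto)
  then show ?thesis
    by (simp add: gbinomial_pochhammer abs_mult power_abs)
qed

text \<open>Only the part of Euler's integral over \<open>{K..K + 1}\<close> is kept, where the
  power is at least its value at \<open>K\<close> and \<open>exp t\<close> is at most
  \<open>exp (K + 1)\<close>. As \<open>K\<close> is arbitrary, Gamma outgrows every geometric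
  sequence.\<close>

lemma Gamma_lower_bound:
  fixes K x :: real
  assumes "K > 0" "x \<ge> 1"
  shows "K powr (x - 1) / exp (K + 1) \<le> Gamma x"
proof -
  have I: "((\<lambda>t. t powr (x - 1) / exp t) has_integral Gamma x) {0..}"
    using assms by (intro Gamma_integral_real) auto
  have "((\<lambda>t. K powr (x - 1) / exp (K + 1)) has_integral
      (K powr (x - 1) / exp (K + 1))) {K..K + 1}"
    using has_integral_const_real[of "K powr (x - 1) / exp (K + 1)" K "K + 1"] by simp
  moreover have J: "((\<lambda>t. t powr (x - 1) / exp t) has_integral
      integral {K..K + 1} (\<lambda>t. t powr (x - 1) / exp t)) {K..K + 1}"
    using assms by (intro integrable_integral integrable_continuous_interval continuous_intros) auto
  ultimately have "K powr (x - 1) / exp (K + 1)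
      \<le> integral {K..K + 1} (\<lambda>t. t powr (x - 1) / exp t)"
  proof (rule has_integral_le)
    fix t assume t: "t \<in> {K..K + 1}"
    show "K powr (x - 1) / exp (K + 1) \<le> t powr (x - 1) / exp t"
      using t assms by (intro frac_le powr_mono2) auto
  qed
  also have "\<dots> \<le> Gamma x"
    by (rule has_integral_subset_le[OF _ J I]) (use assms in auto)
  finally show ?thesis .
qed

lemma prabhakar_summable_abs:
  fixes \<gamma> \<rho> \<delta> z :: real
  assumes "\<rho> > 0" "\<delta> > 0"
  shows "summable (\<lambda>n. \<bar>pochhammer \<gamma> n / (fact n * Gamma (\<rho> * of_nat n + \<delta>)) * z ^ n\<bar>)"
proof -
  \<comment> \<open>\<open>Gamma_lower_bound\<close> with \<open>K powr \<rho> = B > \<bar>z\<bar>\<close> beats \<open>z ^ n\<close>.\<close>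
  define B where "B = 2 * \<bar>z\<bar> + 1"
  define K where "K = B powr (1 / \<rho>)"
  \<comment> \<open>Collects the factors independent of \<open>n\<close>, so that the lower bound
    for \<open>Gamma (\<rho> * real n + \<delta>)\<close> reads \<open>B ^ n / C\<close>.\<close>
  define C where "C = exp (K + 1) * K powr (1 - \<delta>)"
  have "B > 0" by (simp add: B_def add_nonneg_pos)
  then have "K > 0" by (simp add: K_def)
  have K_powr: "K powr (\<rho> * real n) = B ^ n" for n
    using \<open>B > 0\<close> assms by (simp add: K_def powr_powr powr_realpow)
  have "\<bar>z / B\<bar> < 1"
    using \<open>B > 0\<close> by (simp add: B_def abs_divide)
  then have "summable (\<lambda>n. C * \<bar>pochhammer \<gamma> n / fact n * (z / B) ^ n\<bar>)"
    by (intro summable_mult summable_abs_pochhammer_powser)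
  moreover have "\<forall>\<^sub>F n in sequentially.
      norm \<bar>pochhammer \<gamma> n / (fact n * Gamma (\<rho> * of_nat n + \<delta>)) * z ^ n\<bar>
        \<le> C * \<bar>pochhammer \<gamma> n / fact n * (z / B) ^ n\<bar>"
  proof -
    \<comment> \<open>The lower bound requires an argument of at least 1, which holds from
      \<open>n \<ge> 1 / \<rho>\<close> on; the comparison of the two series is therefore an
      eventual one.\<close>
    have "\<forall>\<^sub>F n in sequentially. real n \<ge> 1 / \<rho>"
      using filterlim_real_sequentially by (auto simp: filterlim_at_top)
    then have "\<forall>\<^sub>F n in sequentially. \<rho> * real n + \<delta> \<ge> 1"
      by eventually_elim (use assms in \<open>auto simp: field_simps\<close>)
    then show ?thesis
    proof eventually_elim
      case (elim n)
      have pos: "Gamma (\<rho> * real n + \<delta>) > 0"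
        using elim by (intro Gamma_real_pos) auto
      have "K powr (\<rho> * real n + \<delta> - 1) / exp (K + 1) \<le> Gamma (\<rho> * real n + \<delta>)"
        using \<open>K > 0\<close> elim by (rule Gamma_lower_bound)
      also have "K powr (\<rho> * real n + \<delta> - 1) / exp (K + 1) = B ^ n / C"
        using \<open>K > 0\<close>
        by (simp add: C_def K_powr powr_add powr_diff field_simps)
      finally have "1 / Gamma (\<rho> * real n + \<delta>) \<le> C / B ^ n"
        using pos \<open>K > 0\<close> \<open>B > 0\<close> by (simp add: C_def field_simps)
      then have "\<bar>pochhammer \<gamma> n / fact n * z ^ n\<bar> * (1 / Gamma (\<rho> * real n + \<delta>))
          \<le> \<bar>pochhammer \<gamma> n / fact n * z ^ n\<bar> * (C / B ^ n)"
        by (rule mult_left_mono) auto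
      then show ?case
        using pos \<open>B > 0\<close> by (simp add: abs_mult abs_divide power_divide power_abs mult_ac)
    qed
  qed
  ultimately show ?thesis
    by (rule summable_comparison_test_ev[rotated])
qed

lemmas prabhakar_summable = summable_rabs_cancel[OF prabhakar_summable_abs]

lemma continuous_on_prabhakar:
  fixes \<gamma> \<rho> \<delta> :: real
  assumes "\<rho> > 0" "\<delta> > 0"
  shows "continuous_on A (prabhakar \<gamma> \<rho> \<delta>)"
proof -
  have "isCont (\<lambda>z. \<Sum>n. pochhammer \<gamma> n / (fact n * Gamma (\<rho> * of_nat n + \<delta>)) * z ^ n) z" for z
    by (intro isCont_powser_converges_everywhere prabhakar_summable assms)
  then show ?thesis
    unfolding prabhakar_def by (intro continuous_at_imp_continuous_on) auto
qed

section \<open>Termwise Laplace transform of the Prabhakar series\<close>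

text \<open>Integrating the \<open>n\<close>-th term produces
  \<open>Gamma (\<rho> * n + \<delta>)\<close>, which cancels the denominator and leaves the
  binomial series in \<open>x = c * s powr (- \<rho>)\<close>. The bound on \<open>c\<close> says
  exactly that \<open>\<bar>x\<bar> < 1\<close>, and absolute convergence there justifies exchanging
  sum and integral.\<close>

lemma Laplace_prabhakar:
  fixes \<gamma> \<rho> \<delta> c s :: real
  assumes "\<rho> > 0" "\<delta> > 0" "s > 0" and c: "\<bar>c\<bar> < s powr \<rho>"
  shows "has_bochner_integral (lebesgue_on {0<..})
    (\<lambda>t. exp (- s * t) * (t powr (\<delta> - 1) * prabhakar \<gamma> \<rho> \<delta> (c * t powr \<rho>)))
    (s powr (- \<delta>) * (1 - c * s powr (- \<rho>)) powr (- \<gamma>))"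
proof -
  let ?M = "lebesgue_on {0::real<..}"
  define a where "a n = pochhammer \<gamma> n / (fact n * Gamma (\<rho> * of_nat n + \<delta>))" for n
  define f :: "nat \<Rightarrow> real \<Rightarrow> real" where "f n t = a n * c ^ n * (exp (- s * t) * t powr (\<rho> * of_nat n + \<delta> - 1))"
    for n t
  define x where "x = c * s powr (- \<rho>)"
  have x: "\<bar>x\<bar> < 1"
    using c \<open>s > 0\<close> by (simp add: x_def abs_mult powr_minus field_simps)
  have Gamma_pos: "Gamma (\<rho> * real n + \<delta>) > 0" for n
    using assms by (intro Gamma_real_pos add_nonneg_pos) auto
  have power_s: "s powr (- (\<rho> * real n + \<delta>)) = s powr (- \<delta>) * (s powr (- \<rho>)) ^ n" for n
    using \<open>s > 0\<close> by (simp add: powr_minus powr_add powr_diff powr_powr inverse_eq_divide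
        power_one_over flip: powr_realpow)
  have pow: "has_bochner_integral ?M (\<lambda>t. exp (- s * t) * t powr (\<rho> * of_nat n + \<delta> - 1))
      (Gamma (\<rho> * of_nat n + \<delta>) * (s powr (- \<delta>) * (s powr (- \<rho>)) ^ n))" for n
    using Laplace_power[of s "\<rho> * of_nat n + \<delta>"] assms
    unfolding power_s by (simp add: add_nonneg_pos)
  have f: "has_bochner_integral ?M (f n)
      (s powr (- \<delta>) * (pochhammer \<gamma> n / fact n * x ^ n))" for n
    using has_bochner_integral_mult_right[OF pow, of "a n * c ^ n" n] Gamma_pos[of n]
    by (simp add: f_def[abs_def] a_def x_def power_mult_distrib field_simps)
  \<comment> \<open>Each \<open>f n\<close> has constant sign on the half-line, so its norm
    integrates to the absolute value of its integral.\<close>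
  have norm_f: "has_bochner_integral ?M (\<lambda>t. norm (f n t))
      (s powr (- \<delta>) * \<bar>pochhammer \<gamma> n / fact n * x ^ n\<bar>)" for n
    using has_bochner_integral_mult_right[OF pow, of "\<bar>a n * c ^ n\<bar>" n] Gamma_pos[of n] \<open>s > 0\<close>
    by (simp add: f_def[abs_def] a_def x_def power_mult_distrib field_simps abs_mult)
  have f_eq: "f n t = exp (- s * t) * t powr (\<delta> - 1) * (a n * (c * t powr \<rho>) ^ n)"
    if "t > 0" for n t
    using that by (simp add: f_def powr_add powr_diff powr_powr power_mult_distrib
        flip: powr_realpow)
  have abs_sum: "summable (\<lambda>n. norm (f n t))" if "t > 0" for t
    unfolding f_eq[OF that] real_norm_def abs_mult[of "exp _ * _"]
    by (intro summable_mult) (use prabhakar_summable_abs assms in \<open>auto simp: a_def\<close>)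
  have sum_f: "(\<Sum>n. f n t) = exp (- s * t) * (t powr (\<delta> - 1) * prabhakar \<gamma> \<rho> \<delta> (c * t powr \<rho>))"
    if "t > 0" for t
    unfolding f_eq[OF that] prabhakar_def a_def mult.assoc[symmetric, of "exp _"]
    by (intro suminf_mult prabhakar_summable assms)
  have int_f: "integrable ?M (f n)" for n
    using f by (simp add: has_bochner_integral_iff)
  have AE_sum: "AE t in ?M. summable (\<lambda>n. norm (f n t))"
    by (rule AE_I2, rule abs_sum) simp
  have "summable (\<lambda>n. s powr (- \<delta>) * \<bar>pochhammer \<gamma> n / fact n * x ^ n\<bar>)"
    by (intro summable_mult summable_abs_pochhammer_powser x)
  then have sum_int: "summable (\<lambda>n. \<integral>t. norm (f n t) \<partial>?M)"
    using norm_f by (simp add: has_bochner_integral_iff)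
  \<comment> \<open>These are the three hypotheses for exchanging sum and integral: integrable
    terms, pointwise absolute summability, and summable integrals of the norms.\<close>
  note * = int_f AE_sum sum_int
  have "(\<lambda>n. ((- \<gamma>) gchoose n) * (- x) ^ n) sums (1 - x) powr (- \<gamma>)"
    using gen_binomial_real[of "- x" "- \<gamma>"] x by simp
  \<comment> \<open>The sign \<open>(-1) ^ n\<close> relating the generalized binomial coefficient
    to the Pochhammer symbol cancels that of \<open>(- x) ^ n\<close>.\<close>
  also have "(\<lambda>n. ((- \<gamma>) gchoose n) * (- x) ^ n) = (\<lambda>n. pochhammer \<gamma> n / fact n * x ^ n)"
    by (rule ext) (simp add: gbinomial_pochhammer flip: power_mult_distrib)
  finally have "(\<lambda>n. s powr (- \<delta>) * (pochhammer \<gamma> n / fact n * x ^ n)) sums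
      (s powr (- \<delta>) * (1 - x) powr (- \<gamma>))"
    by (rule sums_mult)
  moreover have "(\<lambda>n. s powr (- \<delta>) * (pochhammer \<gamma> n / fact n * x ^ n)) sums
      (\<integral>t. (\<Sum>n. f n t) \<partial>?M)"
    using sums_integral[OF *] f by (simp add: has_bochner_integral_iff)
  ultimately have "(\<integral>t. (\<Sum>n. f n t) \<partial>?M) = s powr (- \<delta>) * (1 - x) powr (- \<gamma>)"
    by (metis sums_unique2)
  then have "has_bochner_integral ?M (\<lambda>t. \<Sum>n. f n t) (s powr (- \<delta>) * (1 - x) powr (- \<gamma>))"
    using integrable_suminf[OF *] by (simp add: has_bochner_integral_iff)
  then show ?thesis
    by (subst has_bochner_integral_cong[OF refl _ refl, of _ _ "\<lambda>t. \<Sum>n. f n t"])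
      (auto simp: sum_f x_def)
qed

section \<open>From almost everywhere to everywhere, and uniqueness for complex transforms\<close>

text \<open>The points of \<open>S\<close> where the two functions differ form an open set, and a
  nonempty open set is not negligible.\<close>

lemma continuous_on_AE_eq_imp_eq:
  fixes f g :: "'a::euclidean_space \<Rightarrow> 'b::real_normed_vector"
  assumes "open S" "continuous_on S f" "continuous_on S g"
    and eq: "AE x in lebesgue_on S. f x = g x" and "x \<in> S"
  shows "f x = g x"
proof (rule ccontr)
  assume "f x \<noteq> g x"
  define V where "V = S \<inter> (\<lambda>x. f x - g x) -` (- {0})"
  have "open V"
    unfolding V_def using assms by (intro continuous_open_preimage continuous_intros) auto
  moreover have "x \<in> V"
    using \<open>x \<in> S\<close> \<open>f x \<noteq> g x\<close> by (simp add: V_def)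
  ultimately have "\<not> negligible V"
    using open_not_negligible by blast
  moreover have "AE x in lebesgue. x \<in> S \<longrightarrow> f x = g x"
    using eq \<open>open S\<close> by (subst (asm) AE_restrict_space_iff) auto
  then obtain N where "{x \<in> space lebesgue. \<not> (x \<in> S \<longrightarrow> f x = g x)} \<subseteq> N" "N \<in> null_sets lebesgue"
    by (elim AE_E3) auto
  then have "negligible V"
    by (intro negligible_subset[of N V]) (auto simp: negligible_iff_null_sets V_def)
  ultimately show False by contradiction
qed

lemma laplace_converges_iff_integrable:
  "laplace_converges g s \<longleftrightarrow>
    integrable (lebesgue_on {0<..}) (\<lambda>t. exp (- (s * of_real t)) * g t)"
  by (simp add: laplace_converges_def set_integrable_def integrable_restrict_space)

lemma laplace_eq_integral:
  "laplace g s = (\<integral>t. exp (- (s * of_real t)) * g t \<partial>lebesgue_on {0<..})"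
  by (simp add: laplace_def set_lebesgue_integral_def integral_restrict_space)

lemma laplace_of_real:
  assumes "has_bochner_integral (lebesgue_on {0<..}) (\<lambda>t. exp (- s * t) * p t) I"
  shows "laplace_converges (\<lambda>t. of_real (p t)) (of_real s)"
    and "laplace (\<lambda>t. of_real (p t)) (of_real s) = of_real I"
proof -
  have eq: "exp (- (of_real s * of_real t)) * of_real (p t)
      = (of_real (exp (- s * t) * p t) :: complex)" for t
    by (simp flip: exp_of_real)
  have "has_bochner_integral (lebesgue_on {0<..})
      (\<lambda>t. of_real (exp (- s * t) * p t) :: complex) (of_real I)"
    using assms by (rule has_bochner_integral_of_real)
  then show "laplace_converges (\<lambda>t. of_real (p t)) (of_real s)"
    and "laplace (\<lambda>t. of_real (p t)) (of_real s) = of_real I"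
    unfolding laplace_converges_iff_integrable laplace_eq_integral eq
    by (simp_all add: has_bochner_integral_iff)
qed

text \<open>Reduces to vanishing moments of the real and imaginary parts of the weighted difference
  \<open>h\<close>; the exponential weights are real at these points, so they commute with
  \<open>Re\<close> and \<open>Im\<close>.\<close>

lemma laplace_unique_on_naturals:
  assumes f: "\<And>k. laplace_converges f (of_nat (Suc k))"
    and g: "\<And>k. laplace_converges g (of_nat (Suc k))"
    and eq: "\<And>k. laplace f (of_nat (Suc k)) = laplace g (of_nat (Suc k))"
  shows "AE t in lebesgue_on {0<..}. f t = g t"
proof -
  let ?M = "lebesgue_on {0::real<..}"
  \<comment> \<open>One factor \<open>exp (- t)\<close> is absorbed into \<open>h\<close>:
    \<open>f - g\<close> itself need not be integrable, whereas \<open>h\<close> is, by convergence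
    at 1. The transform at \<open>Suc k\<close> thereby becomes the moment of index
    \<open>k\<close>, starting from 0.\<close>
  define h where "h t = exp (- of_real t) * (f t - g t)" for t
  have "exp (- (of_nat (Suc k) * of_real t)) = of_real (exp (- real k * t)) * exp (- of_real t :: complex)"
    for k t
    by (simp add: algebra_simps flip: exp_of_real exp_add)
  then have h_eq: "of_real (exp (- real k * t)) * h t =
      exp (- (of_nat (Suc k) * of_real t)) * f t - exp (- (of_nat (Suc k) * of_real t)) * g t"
    for k t
    by (simp add: h_def right_diff_distrib mult.assoc del: of_nat_Suc)
  have h: "has_bochner_integral ?M (\<lambda>t. of_real (exp (- real k * t)) * h t) 0" for k
    unfolding h_eq using f[of k] g[of k] eq[of k]
    by (simp add: has_bochner_integral_iff laplace_converges_iff_integrable laplace_eq_integral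
        del: of_nat_Suc)
  have "AE t in ?M. Re (h t) = 0"
  proof (rule AE_zero_if_exp_moments_zero)
    show "integrable ?M (\<lambda>t. Re (h t))"
      using h[of 0] by (intro integrable_Re) (simp add: has_bochner_integral_iff)
    show "(\<integral>t. exp (- real k * t) * Re (h t) \<partial>?M) = 0" for k
      using integral_Re[of ?M "\<lambda>t. of_real (exp (- real k * t)) * h t"] h[of k]
      by (simp add: has_bochner_integral_iff)
  qed
  moreover have "AE t in ?M. Im (h t) = 0"
  proof (rule AE_zero_if_exp_moments_zero)
    show "integrable ?M (\<lambda>t. Im (h t))"
      using h[of 0] by (intro integrable_Im) (simp add: has_bochner_integral_iff)
    show "(\<integral>t. exp (- real k * t) * Im (h t) \<partial>?M) = 0" for k
      using integral_Im[of ?M "\<lambda>t. of_real (exp (- real k * t)) * h t"] h[of k]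
      by (simp add: has_bochner_integral_iff)
  qed
  ultimately show ?thesis
  proof eventually_elim
    case (elim t)
    then have "h t = 0" by (simp add: complex_eq_iff)
    then show ?case by (simp add: h_def)
  qed
qed

section \<open>Identification of the kernel\<close>

text \<open>On the positive real axis both bases are nonnegative reals, where the principal complex
  power agrees with the real one.\<close>

lemma Phi_of_real:
  assumes "s > 0" "\<alpha> \<le> 1"
  shows "Phi \<alpha> \<beta> (of_real s) / of_real s =
    of_real (s powr (\<alpha> - 1) * (1 + (1 - \<alpha>) * s powr (\<alpha> - 1)) powr (- \<beta>))"
proof -
  define u where "u = 1 + (1 - \<alpha>) * s powr (\<alpha> - 1)"
  have "u \<ge> 0"
    using assms by (simp add: u_def)
  have "Phi \<alpha> \<beta> (of_real s) = of_real (s powr \<alpha>) * of_real u powr of_real (- \<beta>)"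
    using assms unfolding Phi_def u_def
    by (simp add: powr_of_real flip: of_real_diff of_real_minus)
  also have "of_real u powr of_real (- \<beta>) = (of_real (u powr (- \<beta>)) :: complex)"
    using \<open>u \<ge> 0\<close> by (rule powr_of_real)
  finally show ?thesis
    using assms by (simp add: u_def powr_diff)
qed

theorem proposition4p3:
  fixes \<alpha> \<beta> t :: real and w :: "real \<Rightarrow> complex"
  assumes "0 < \<alpha>" and "\<alpha> < 1" and "0 \<le> \<beta>"
    and "is_kernel \<alpha> \<beta> w"
    and "t > 0"
  shows "continuous_representative w t =
    complex_of_real
      (t powr (- \<alpha>) * prabhakar \<beta> (1 - \<alpha>) (1 - \<alpha>) (- (1 - \<alpha>) * t powr (1 - \<alpha>)))"
proof -
  define p where "p t = t powr (- \<alpha>) * prabhakar \<beta> (1 - \<alpha>) (1 - \<alpha>) (- (1 - \<alpha>) * t powr (1 - \<alpha>))"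
    for t
  have p_cont: "continuous_on {0<..} (\<lambda>t. complex_of_real (p t))"
    unfolding p_def using \<open>\<alpha> < 1\<close>
    by (intro continuous_intros continuous_on_compose2[OF continuous_on_prabhakar[of _ _ UNIV]]) auto
  have p_laplace: "laplace_converges (\<lambda>t. of_real (p t)) (of_nat (Suc k))"
    "laplace (\<lambda>t. of_real (p t)) (of_nat (Suc k)) = Phi \<alpha> \<beta> (of_nat (Suc k)) / of_nat (Suc k)" for k
  proof -
    define s where "s = real (Suc k)"
    have "s > 0" by (simp add: s_def)
    \<comment> \<open>Integers \<open>s \<ge> 1\<close> lie in the region where the termwise
      transform is available, since \<open>1 - \<alpha> < 1 \<le> s powr (1 - \<alpha>)\<close>; for
      small positive \<open>s\<close> the binomial series would diverge.\<close>
    have "1 \<le> s powr (1 - \<alpha>)"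
      using \<open>\<alpha> < 1\<close> by (intro ge_one_powr_ge_zero) (auto simp: s_def)
    then have "\<bar>- (1 - \<alpha>)\<bar> < s powr (1 - \<alpha>)"
      using assms by auto
    moreover have exponent: "s powr (\<alpha> - 1) = s powr (- (1 - \<alpha>))"
      by simp
    ultimately have "has_bochner_integral (lebesgue_on {0<..}) (\<lambda>t. exp (- s * t) * p t)
        (s powr (\<alpha> - 1) * (1 + (1 - \<alpha>) * s powr (\<alpha> - 1)) powr (- \<beta>))"
      using Laplace_prabhakar[of "1 - \<alpha>" "1 - \<alpha>" s "- (1 - \<alpha>)" \<beta>] \<open>\<alpha> < 1\<close> \<open>s > 0\<close>
      unfolding exponent by (simp add: p_def del: minus_diff_eq)
    from laplace_of_real[OF this] Phi_of_real[OF \<open>s > 0\<close>, of \<alpha> \<beta>] \<open>\<alpha> < 1\<close>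
    show "laplace_converges (\<lambda>t. of_real (p t)) (of_nat (Suc k))"
      "laplace (\<lambda>t. of_real (p t)) (of_nat (Suc k)) = Phi \<alpha> \<beta> (of_nat (Suc k)) / of_nat (Suc k)"
      by (simp_all add: s_def del: of_nat_Suc)
  qed
  have w: "laplace_converges w (of_nat (Suc k))"
    "laplace w (of_nat (Suc k)) = Phi \<alpha> \<beta> (of_nat (Suc k)) / of_nat (Suc k)" for k
    using \<open>is_kernel \<alpha> \<beta> w\<close> by (auto simp: is_kernel_def simp del: of_nat_Suc)
  have AE_p: "AE t in lebesgue_on {0<..}. complex_of_real (p t) = w t"
    by (rule laplace_unique_on_naturals) (simp_all add: p_laplace w del: of_nat_Suc)
  let ?v = "continuous_representative w"
  \<comment> \<open>The function \<open>p\<close> witnesses that a continuous representative exists,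
    so the choice operator returns a function with the defining properties.\<close>
  have "continuous_on {0<..} ?v \<and> (AE t in lebesgue_on {0<..}. ?v t = w t)"
    unfolding continuous_representative_def
    by (rule someI[of _ "\<lambda>t. complex_of_real (p t)"]) (use p_cont AE_p in auto)
  then have v_cont: "continuous_on {0<..} ?v" and AE_v: "AE t in lebesgue_on {0<..}. ?v t = w t"
    by auto
  from AE_p AE_v have "AE t in lebesgue_on {0<..}. ?v t = complex_of_real (p t)"
    by eventually_elim simp
  then have "?v t = complex_of_real (p t)"
    by (rule continuous_on_AE_eq_imp_eq[OF open_greaterThan v_cont p_cont]) (use \<open>t > 0\<close> in simp)
  then show ?thesis by (simp add: p_def)
qed

end
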